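(* Let $k\geq 1$ and write $k=k'2^\ell$ with $k'$ odd and $\ell\ge 0$. Then $\alpha(k) = \frac{m(k)}{2} - \frac{2\cdot 4^{\ell-1}+1}{3}$.
   Context: Let $(a(n))_{n\ge 0}$ be the Rudin-Shapiro sequence, defined by $a(0)=1$, $a(2n)=a(n)$, $a(2n+1)=(-1)^n a(n)$ for $n\ge 0$. Let $s(n)=\sum_{0\le i\le n} a(i)$. For $k\ge 1$, $\alpha(k)$ is the smallest $n\ge 0$ with $s(n)=k$. For $k\ge 0$, $m(k)$ denotes the integer obtained by reading the base-$2$ representation of $k$ as a base-$4$ numeral; i.e., if $k=\sum_i c_i 2^i$ with $c_i\in\{0,1\}$, then $m(k)=\sum_i c_i 4^i$. *)

theory Defs
  imports Complex_Main
begin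

fun rudin_shapiro :: "nat \<Rightarrow> int" where
  "rudin_shapiro n =
    (if n = 0 then 1
     else if even n then rudin_shapiro (n div 2)
     else (- 1) ^ (n div 2) * rudin_shapiro (n div 2))"

declare rudin_shapiro.simps [simp del]

lemma rudin_shapiro_0: "rudin_shapiro 0 = 1"
  by (simp add: rudin_shapiro.simps)

lemma rudin_shapiro_even: "rudin_shapiro (2 * n) = rudin_shapiro n"
  by (cases "n = 0") (simp, subst rudin_shapiro.simps, simp)

lemma rudin_shapiro_odd: "rudin_shapiro (2 * n + 1) = (- 1) ^ n * rudin_shapiro n"
  by (subst rudin_shapiro.simps) simp

definition rs_sum :: "nat \<Rightarrow> int" where
  "rs_sum n = (\<Sum>i\<le>n. rudin_shapiro i)"

definition rs_alpha :: "nat \<Rightarrow> nat" where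
  "rs_alpha k = (LEAST n. rs_sum n = int k)"

(* The index set is finite by finite_bits, so the sum is never degenerate. *)
definition base2_as_base4 :: "nat \<Rightarrow> nat" where
  "base2_as_base4 k = (\<Sum>i | bit k i. 4 ^ i)"

lemma finite_bits: "finite {i. bit (k::nat) i}"
proof (rule finite_subset)
  show "{i. bit k i} \<subseteq> {..<k}"
  proof
    fix i assume "i \<in> {i. bit k i}"
    then have "odd (k div 2 ^ i)" by (simp add: bit_iff_odd)
    then have "2 ^ i \<le> k" by (metis div_less even_zero not_le)
    with less_exp [of i] have "i < k" by (rule less_le_trans)
    then show "i \<in> {..<k}" by simp
  qed
qed simp

end

theory Submission
  imports Defs
begin

text \<open>
  Summing the Rudin-Shapiro sequence in blocks of four gives \<open>s (4 q + 1) = s (4 q + 3) = 2 s q\<close>,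
  \<open>s (4 q) = 2 s q - a q\<close> and \<open>s (4 q + 2) = 2 s q + (-1)^q a q\<close>. Since \<open>s\<close> starts at 1 and moves by
  unit steps, the first visit to \<open>k\<close> is the first time that \<open>s\<close> reaches a new maximum \<open>k\<close>. The block
  formulas turn records of \<open>s\<close> into records: \<open>\<alpha> (2 j) = 4 \<alpha> j + 1\<close>,
  \<open>\<alpha> (2 j + 1) = 4 \<alpha> j + 2\<close> for odd \<open>j\<close> and \<open>\<alpha> (2 j + 1) = 4 \<alpha> (j + 1)\<close> for even \<open>j\<close>.
  Hence \<open>\<alpha> (2 j + 1) = 2 m j\<close>, and the factor \<open>2 ^ l\<close> is handled by the first recursion.
\<close>

lemma base2_as_base4_0: "base2_as_base4 0 = 0"
  by (simp add: base2_as_base4_def)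

lemma base2_as_base4_even: "base2_as_base4 (2 * k) = 4 * base2_as_base4 k"
proof -
  have "{i. bit (2 * k) i} = Suc ` {i. bit k i}"
    by (auto simp: bit_double_iff image_iff gr0_conv_Suc)
  then show ?thesis
    by (simp add: base2_as_base4_def sum.reindex sum_distrib_left)
qed

lemma base2_as_base4_odd: "base2_as_base4 (2 * k + 1) = 4 * base2_as_base4 k + 1"
proof -
  have "bit (2 * k + 1) i \<longleftrightarrow> i = 0 \<or> i \<in> Suc ` {i. bit k i}" for i
    by (cases i) (auto simp: bit_0 bit_Suc)
  then have "{i. bit (2 * k + 1) i} = insert 0 (Suc ` {i. bit k i})"
    by auto
  then show ?thesis
    by (simp add: base2_as_base4_def sum.reindex sum_distrib_left finite_bits)
qed

lemma rudin_shapiro_cases: "rudin_shapiro n = 1 \<or> rudin_shapiro n = - 1"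
proof (induction n rule: less_induct)
  case (less n)
  show ?case
  proof (cases "n = 0")
    case False
    then have "rudin_shapiro (n div 2) = 1 \<or> rudin_shapiro (n div 2) = - 1"
      by (intro less) simp
    with False show ?thesis
      by (subst (1 2) rudin_shapiro.simps) (auto simp: minus_one_power_iff)
  qed (simp add: rudin_shapiro_0)
qed

lemma rudin_shapiro_mod4:
  "rudin_shapiro (4 * q) = rudin_shapiro q"
  "rudin_shapiro (4 * q + 1) = rudin_shapiro q"
  "rudin_shapiro (4 * q + 2) = (- 1) ^ q * rudin_shapiro q"
  "rudin_shapiro (4 * q + 3) = - ((- 1) ^ q * rudin_shapiro q)"
proof -
  have eqs: "4 * q = 2 * (2 * q)" "4 * q + 1 = 2 * (2 * q) + 1"
    "4 * q + 2 = 2 * (2 * q + 1)" "4 * q + 3 = 2 * (2 * q + 1) + 1"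
    by simp_all
  show "rudin_shapiro (4 * q) = rudin_shapiro q"
    unfolding eqs(1) rudin_shapiro_even ..
  show "rudin_shapiro (4 * q + 1) = rudin_shapiro q"
    unfolding eqs(2) rudin_shapiro_odd rudin_shapiro_even by simp
  show "rudin_shapiro (4 * q + 2) = (- 1) ^ q * rudin_shapiro q"
    unfolding eqs(3) rudin_shapiro_odd rudin_shapiro_even ..
  show "rudin_shapiro (4 * q + 3) = - ((- 1) ^ q * rudin_shapiro q)"
    unfolding eqs(4) rudin_shapiro_odd by simp
qed

lemma rs_sum_0: "rs_sum 0 = 1"
  by (simp add: rs_sum_def rudin_shapiro_0)

lemma rs_sum_Suc: "rs_sum (Suc n) = rs_sum n + rudin_shapiro (Suc n)"
  by (simp add: rs_sum_def)

text \<open>In each block of four the first two terms equal a q and the last two cancel.\<close>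

lemma rs_sum_4q3: "rs_sum (4 * q + 3) = 2 * rs_sum q"
proof (induction q)
  case 0
  show ?case
    using rudin_shapiro_mod4 [of 0]
    by (simp add: rs_sum_Suc rs_sum_0 numeral_eq_Suc rudin_shapiro_0)
next
  case (Suc q)
  then show ?case
    using rudin_shapiro_mod4 [of "Suc q"]
    by (simp add: rs_sum_Suc numeral_eq_Suc)
qed

lemma rs_sum_mod4:
  "rs_sum (4 * q) = 2 * rs_sum q - rudin_shapiro q"
  "rs_sum (4 * q + 1) = 2 * rs_sum q"
  "rs_sum (4 * q + 2) = 2 * rs_sum q + (- 1) ^ q * rudin_shapiro q"
  using rudin_shapiro_mod4 [of q] rs_sum_4q3 [of q]
  by (simp_all add: rs_sum_Suc numeral_eq_Suc)

lemma even_rs_sum: "even (rs_sum n) \<longleftrightarrow> odd n"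
proof (induction n)
  case (Suc n)
  then show ?case
    using rudin_shapiro_cases [of "Suc n"] by (auto simp: rs_sum_Suc)
qed (simp add: rs_sum_0)

text \<open>Bounding the earlier values from above, rather than only excluding \<open>k\<close>,
  gives a condition that the block formulas can propagate.\<close>

definition rs_record :: "nat \<Rightarrow> nat \<Rightarrow> bool" where
  "rs_record n k \<longleftrightarrow> rs_sum n = int k \<and> (\<forall>i<n. rs_sum i < int k)"

lemma rs_alpha_eq_record: "rs_record n k \<Longrightarrow> rs_alpha k = n"
  unfolding rs_alpha_def rs_record_def
  by (intro Least_equality) (auto simp: not_less [symmetric])

text \<open>A record is entered by an upward step; at index 0 the value is 1 anyway.\<close>

lemma rudin_shapiro_record: "rs_record n k \<Longrightarrow> rudin_shapiro n = 1"
  using rudin_shapiro_cases [of n]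
  by (cases n) (auto simp: rs_record_def rs_sum_Suc rudin_shapiro_0)

lemma div4_cases:
  fixes i q :: nat
  assumes "i div 4 = q"
  obtains "i = 4 * q" | "i = 4 * q + 1" | "i = 4 * q + 2" | "i = 4 * q + 3"
  using assms by linarith

lemma rs_sum_block_le:
  assumes "i div 4 = q"
  shows "rs_sum i \<le> 2 * rs_sum q + 1"
  using assms
proof (cases rule: div4_cases)
qed (use rs_sum_mod4 [of q] rs_sum_4q3 [of q] rudin_shapiro_cases [of q] in
    \<open>auto simp: minus_one_power_iff split: if_splits\<close>)

lemma rs_sum_before_record:
  assumes "rs_record n k" "i < 4 * n"
  shows "rs_sum i < 2 * int k"
proof -
  have "i div 4 < n" using assms(2) by auto
  then have "rs_sum (i div 4) < int k" using assms(1) by (simp add: rs_record_def)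
  then show ?thesis using rs_sum_block_le [of i "i div 4"] by simp
qed

text \<open>Earlier blocks stay below 2k, and block \<open>n\<close> itself opens with 2k - 1, then
  2k.\<close>

lemma rs_record_double:
  assumes "rs_record n k"
  shows "rs_record (4 * n + 1) (2 * k)"
  unfolding rs_record_def
proof (intro conjI allI impI)
  show "rs_sum (4 * n + 1) = int (2 * k)"
    using assms rs_sum_mod4(2) [of n] by (simp add: rs_record_def)
  fix i assume "i < 4 * n + 1"
  then consider "i < 4 * n" | "i = 4 * n" by linarith
  then show "rs_sum i < int (2 * k)"
    using rs_sum_before_record [OF assms, of i] rs_sum_mod4(1) [of n]
      rudin_shapiro_record [OF assms] assms
    by cases (auto simp: rs_record_def)
qed

text \<open>By parity \<open>n\<close> is even, so the sign (-1)^n is positive and s rises again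
  right after reaching 2k.\<close>

lemma rs_record_odd:
  assumes "rs_record n k" "odd k"
  shows "rs_record (4 * n + 2) (2 * k + 1)"
  unfolding rs_record_def
proof (intro conjI allI impI)
  have s: "rs_sum n = int k" using assms(1) by (simp add: rs_record_def)
  then have "even n" using even_rs_sum [of n] assms(2) by simp
  then show "rs_sum (4 * n + 2) = int (2 * k + 1)"
    using rs_sum_mod4(3) [of n] rudin_shapiro_record [OF assms(1)] s by simp
  fix i assume "i < 4 * n + 2"
  then consider "i < 4 * n + 1" | "i = 4 * n + 1" by linarith
  then show "rs_sum i < int (2 * k + 1)"
    using rs_record_double [OF assms(1)] by cases (auto simp: rs_record_def)
qed

text \<open>The target is 2(k + 1) - 1, the opening value of block \<open>n\<close>. Only an earlier
  block with s q = k could reach it sooner.\<close>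

lemma rs_record_even:
  assumes "rs_record n (k + 1)" "even k"
  shows "rs_record (4 * n) (2 * k + 1)"
  unfolding rs_record_def
proof (intro conjI allI impI)
  show "rs_sum (4 * n) = int (2 * k + 1)"
    using rs_sum_mod4(1) [of n] rudin_shapiro_record [OF assms(1)] assms(1)
    by (simp add: rs_record_def)
  fix i assume i: "i < 4 * n"
  define q where "q = i div 4"
  have "q < n" using i by (auto simp: q_def)
  have before: "rs_sum j \<le> int k" if "j \<le> q" for j
  proof -
    have "j < n" using that \<open>q < n\<close> by simp
    then have "rs_sum j < int (k + 1)" using assms(1) by (simp add: rs_record_def)
    then show ?thesis by simp
  qed
  show "rs_sum i < int (2 * k + 1)"
  proof (cases "rs_sum q = int k")
    case True
    then have "odd q" using even_rs_sum [of q] assms(2) by simp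
    then obtain p where p: "q = Suc p" by (cases q) auto
    \<comment> \<open>A step down to \<open>k\<close> would come from \<open>k + 1\<close>, before the first visit to \<open>k + 1\<close>.\<close>
    have "rudin_shapiro q = 1"
      using rudin_shapiro_cases [of q] before [of p] True by (auto simp: p rs_sum_Suc)
    \<comment> \<open>Block \<open>q\<close> runs through 2k - 1, 2k, 2k - 1, 2k.\<close>
    with True \<open>odd q\<close> show ?thesis
      using rs_sum_mod4 [of q] rs_sum_4q3 [of q]
      by (cases rule: div4_cases [OF q_def [symmetric]]) simp_all
  next
    case False
    with before [of q] rs_sum_block_le [of i q] show ?thesis by (simp add: q_def)
  qed
qed

text \<open>Both odd-index recursions lead back to 2i + 1 with i = j div 2, so they match the digit
  recursion of m.\<close>

lemma rs_record_at_odd: "rs_record (2 * base2_as_base4 j) (2 * j + 1)"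
proof (induction j rule: less_induct)
  case (less j)
  show ?case
  proof (cases "even j")
    case True
    then obtain i where i: "j = 2 * i" by blast
    show ?thesis
    \<comment> \<open>For j = 0 the recursion would refer to itself.\<close>
    proof (cases "i = 0")
      case True
      then show ?thesis by (simp add: i base2_as_base4_0 rs_record_def rs_sum_0)
    next
      case False
      then have "rs_record (2 * base2_as_base4 i) (j + 1)"
        using less [of i] by (simp add: i)
      from rs_record_even [OF this \<open>even j\<close>] show ?thesis
        by (simp add: i base2_as_base4_even)
    qed
  next
    case False
    then obtain i where i: "j = 2 * i + 1" by (blast elim: oddE)
    then have "rs_record (2 * base2_as_base4 i) j"
      using less [of i] by simp
    from rs_record_odd [OF this False] show ?thesis
      using base2_as_base4_odd [of i] by (simp add: i)
  qed
qed

text \<open>The equation is the claimed formula multiplied by 6, free of subtraction and fractions.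
  Doubling sends \<open>n\<close> to 4n + 1 and multiplies both sides by 4.\<close>

lemma rs_record_exists:
  assumes "odd k"
  shows "\<exists>n. rs_record n (k * 2 ^ l) \<and> 6 * n + 4 ^ l + 2 = 3 * base2_as_base4 (k * 2 ^ l)"
proof (induction l)
  case 0
  from assms obtain j where j: "k = 2 * j + 1" by (blast elim: oddE)
  then show ?case
    using rs_record_at_odd [of j] base2_as_base4_odd [of j]
    by (intro exI [of _ "2 * base2_as_base4 j"]) simp
next
  case (Suc l)
  then obtain n where n: "rs_record n (k * 2 ^ l)"
    "6 * n + 4 ^ l + 2 = 3 * base2_as_base4 (k * 2 ^ l)" by blast
  have eq: "k * 2 ^ Suc l = 2 * (k * 2 ^ l)" by simp
  show ?case
    unfolding eq base2_as_base4_even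
    using rs_record_double [OF n(1)] n(2)
    by (intro exI [of _ "4 * n + 1"]) simp
qed

theorem theorem29:
  fixes k k' l :: nat
  assumes "k \<ge> 1"
    and "k = k' * 2 ^ l"
    and "odd k'"
  shows "real (rs_alpha k) =
    real (base2_as_base4 k) / 2 - (2 * 4 powi (int l - 1) + 1) / 3"
proof -
  obtain n where n: "rs_record n k" "6 * n + 4 ^ l + 2 = 3 * base2_as_base4 k"
    using rs_record_exists [OF assms(3)] assms(2) by blast
  have "real (6 * n + 4 ^ l + 2) = real (3 * base2_as_base4 k)"
    using n(2) by (rule arg_cong)
  \<comment> \<open>This form also covers l = 0, where the exponent is -1.\<close>
  moreover have "(4::real) powi (int l - 1) = 4 ^ l / 4"
    by (simp add: power_int_diff)
  ultimately show ?thesis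
    by (simp add: rs_alpha_eq_record [OF n(1)] field_simps)
qed

end
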